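(* For all non-negative integers $L$, positive integers $p,p'$ such that $p' > p$, and any integer $n\ge 2$, \[ D_{2^np',2^ns}\left(L+2^{n-2}+2^{n-1}(r-s),\,L-2^{n-2}-2^{n-1}(r-s);\,\frac{\frac{2^{2n}-1}{3}(2p'-1)-\frac{2^{2n+1}+1}{3}r+p}{2^n},\,\frac{\frac{2^{2n+1}+1}{3}r+\frac{2^{2n}-1}{3}}{2^n}\right) \ge 0, \] where $r$, $s$ are integers such that $0 < r < p$ and $0 < s < p'$.
   Context: The $q$-binomial coefficient is $\begin{bmatrix}m\\ n\end{bmatrix}_q=\frac{(q;q)_m}{(q;q)_n(q;q)_{m-n}}$ for $m\ge n\ge 0$ and $0$ otherwise, where $(a;q)_L=\prod_{k=0}^{L-1}(1-aq^k)$. For integers $K,i$ and (possibly rational) parameters $N,M,\alpha,\beta$, \[ D_{K,i}(N,M;\alpha,\beta)=\sum_{j\in\mathbb{Z}}\left\{q^{j((\alpha+\beta)Kj+K\beta-(\alpha+\beta)i)}\begin{bmatrix}M+N\\ M-Kj\end{bmatrix}_{q}-q^{((\alpha+\beta)j+\beta)(Kj+i)}\begin{bmatrix}M+N\\ M-Kj-i\end{bmatrix}_{q}\right\}. \] "$P(q)\ge 0$" means the power series $P(q)$ has non-negative coefficients. *)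

theory Defs
  imports "HOL-Computational_Algebra.Polynomial"
begin

definition qpoch :: "nat \<Rightarrow> int poly" where
  "qpoch L = (\<Prod>k<L. 1 - monom 1 (k + 1))"

text \<open>q-binomial coefficient [m choose n]_q; zero unless m \<ge> n \<ge> 0.
  The division is exact.\<close>
definition qbinom :: "int \<Rightarrow> int \<Rightarrow> int poly" where
  "qbinom m n = (if 0 \<le> n \<and> n \<le> m
     then qpoch (nat m) div (qpoch (nat n) * qpoch (nat (m - n))) else 0)"

definition shifted_coeff :: "rat \<Rightarrow> int poly \<Rightarrow> rat \<Rightarrow> int" where
  "shifted_coeff a P e = (if e - a \<in> \<int> \<and> e - a \<ge> 0
     then coeff P (nat \<lfloor>e - a\<rfloor>) else 0)"

text \<open>Coefficient of q^e in D_{K,i}(N,M;alpha,beta). The sum over all integers j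
  is taken over the (finite) set of j for which a summand can be nonzero.\<close>
definition D_coeff :: "int \<Rightarrow> int \<Rightarrow> int \<Rightarrow> int \<Rightarrow> rat \<Rightarrow> rat \<Rightarrow> rat \<Rightarrow> int" where
  "D_coeff K i N M \<alpha> \<beta> e =
     (\<Sum>j\<in>{j::int. qbinom (M + N) (M - K * j) \<noteq> 0 \<or> qbinom (M + N) (M - K * j - i) \<noteq> 0}.
        shifted_coeff (of_int j * ((\<alpha> + \<beta>) * of_int K * of_int j + of_int K * \<beta> - (\<alpha> + \<beta>) * of_int i))
           (qbinom (M + N) (M - K * j)) e
      - shifted_coeff (((\<alpha> + \<beta>) * of_int j + \<beta>) * (of_int K * of_int j + of_int i))
           (qbinom (M + N) (M - K * j - i)) e)"

definition D_nonneg :: "int \<Rightarrow> int \<Rightarrow> int \<Rightarrow> int \<Rightarrow> rat \<Rightarrow> rat \<Rightarrow> bool" where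
  "D_nonneg K i N M \<alpha> \<beta> \<longleftrightarrow> (\<forall>e. D_coeff K i N M \<alpha> \<beta> e \<ge> 0)"

end

theory Submission
  imports Defs
    "HOL-Computational_Algebra.Formal_Laurent_Series"
    "HOL-Computational_Algebra.Polynomial_FPS"
begin

text \<open>
  For integers \<open>\<alpha>, \<beta> \<ge> 0\<close> with \<open>0 < \<alpha> + \<beta> < K\<close> and \<open>\<beta> - i \<le> N - M \<le> K - i - \<alpha>\<close>, the two Pascal rules express
  \<open>D_{K,i}(N,M;\<alpha>,\<beta>)\<close> as a non-negative combination of two such sums with smaller \<open>M + N\<close>, which gives
  positivity by induction. Start from \<open>D_{p',s}(N,M;p-r,r)\<close>, where \<open>N - M\<close> may be \<open>r - s\<close> or, since
  \<open>p' > p\<close>, also \<open>r - s + 1\<close>; thus every row length \<open>M + N\<close> occurs. Two expansions with kernels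
  having non-negative coefficients,
  \<open>q^{v(v+1)/2} [2L+1, L-v] = \<Sum>_m T_m [m, \<lfloor>(m-v)/2\<rfloor>]\<close> and
  \<open>q^{\<lfloor>v^2/2\<rfloor>} [2L, L-v] = \<Sum>_{m \<equiv> v (mod 2)} T'_m [m, (m-v)/2]\<close>,
  then double the offsets from the centre: the first is used once, to reach \<open>n = 1\<close>, and the second
  for each step \<open>n \<rightarrow> n + 1\<close>. Both come from applying the \<open>q\<close>-Vandermonde convolution twice.
\<close>

section \<open>Powers of q and q-binomial coefficients as Laurent series\<close>

text \<open>The monomial q^k. Laurent series are used because single terms of the sums below carry
  negative exponents.\<close>

definition Q :: "int \<Rightarrow> int fls" where
  "Q k = fls_X_intpow k"

lemma Q_0 [simp]: "Q 0 = 1"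
  by (simp add: Q_def)

lemma Q_add: "Q (a + b) = Q a * Q b"
  by (simp only: Q_def fls_X_intpow_times_fls_X_intpow)

lemma Q_mult_nth: "fls_nth (Q a * f) e = fls_nth f (e - a)"
  by (simp add: Q_def fls_X_intpow_times_conv_shift)

lemma Q_of_monom: "fps_to_fls (fps_of_poly (monom 1 k)) = Q (int k)"
  by (simp add: Q_def fps_of_poly_monom' fps_to_fls_power fls_X_power_conv_shift_1)

text \<open>The q-binomial coefficient by its first Pascal rule, which avoids polynomial division.
  Truncating a negative \<open>k\<close> to 0 in the exponent is harmless, since the coefficient it
  multiplies vanishes.\<close>

fun pascal :: "nat \<Rightarrow> int \<Rightarrow> int poly" where
  "pascal 0 k = (if k = 0 then 1 else 0)"
| "pascal (Suc n) k = monom 1 (nat k) * pascal n k + pascal n (k - 1)"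

lemma pascal_eq_0: "k < 0 \<or> int n < k \<Longrightarrow> pascal n k = 0"
  by (induction n arbitrary: k) auto

lemma qpoch_0 [simp]: "qpoch 0 = 1"
  by (simp add: qpoch_def)

lemma qpoch_Suc: "qpoch (Suc n) = (1 - monom 1 (Suc n)) * qpoch n"
  by (simp add: qpoch_def mult.commute)

lemma qpoch_nonzero [simp]: "qpoch n \<noteq> 0"
proof -
  have "coeff (1 - monom 1 (Suc k) :: int poly) 0 = 1" for k
    by simp
  then have "1 - monom 1 (k + 1) \<noteq> (0 :: int poly)" for k
    by (metis Suc_eq_plus1 coeff_0 zero_neq_one)
  then show ?thesis
    by (simp add: qpoch_def)
qed

text \<open>After multiplication by both q-factorials the Pascal rule becomes q^k (1 - q^l) + (1 -
  q^k) = 1 - q^(k+l). This makes the division in \<open>qbinom\<close> exact.\<close>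

lemma pascal_mult_qpoch:
  "pascal (k + l) (int k) * (qpoch k * qpoch l) = qpoch (k + l)"
proof (induction "k + l" arbitrary: k l)
  case 0
  then show ?case by simp
next
  case (Suc n)
  have kl: "k + l = Suc n" using Suc.hyps by simp
  have 1: "pascal n (int k) * (qpoch k * qpoch l) = (1 - monom 1 l) * qpoch n"
  proof (cases l)
    case 0
    then show ?thesis using kl by (simp add: pascal_eq_0)
  next
    case (Suc l')
    then have "n = k + l'" using kl by simp
    from Suc.hyps(1)[OF this] show ?thesis
      unfolding Suc qpoch_Suc \<open>n = k + l'\<close>
      by (metis (no_types, lifting) mult.left_commute)
  qed
  have 2: "pascal n (int k - 1) * (qpoch k * qpoch l) = (1 - monom 1 k) * qpoch n"
  proof (cases k)
    case 0
    then show ?thesis by (simp add: pascal_eq_0)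
  next
    case (Suc k')
    then have "n = k' + l" using kl by simp
    from Suc.hyps(1)[OF this] show ?thesis
      unfolding Suc qpoch_Suc \<open>n = k' + l\<close>
      by (simp add: algebra_simps)
  qed
  have "monom 1 k * monom 1 l = (monom 1 (Suc n) :: int poly)"
    using kl by (simp add: mult_monom)
  then have "monom 1 k * (1 - monom 1 l) + (1 - monom 1 k) = (1 - monom 1 (Suc n) :: int poly)"
    by (simp add: algebra_simps)
  moreover have "pascal (k + l) (int k) * (qpoch k * qpoch l) =
      monom 1 k * (pascal n (int k) * (qpoch k * qpoch l))
      + pascal n (int k - 1) * (qpoch k * qpoch l)"
    by (simp add: kl algebra_simps)
  ultimately show ?case
    by (simp only: 1 2 kl qpoch_Suc) (metis (no_types, lifting) mult.assoc distrib_right)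
qed

lemma qbinom_eq_pascal: "qbinom (int n) k = pascal n k"
proof (cases "0 \<le> k \<and> k \<le> int n")
  case True
  define a b where "a = nat k" and "b = nat (int n - k)"
  have k: "k = int a" and n: "n = a + b" using True by (auto simp: a_def b_def)
  have "qbinom (int n) k = qpoch (a + b) div (qpoch a * qpoch b)"
    by (simp add: qbinom_def k n nat_add_distrib)
  also have "\<dots> = pascal n k"
    unfolding pascal_mult_qpoch[of a b, symmetric] n k
    by (rule nonzero_mult_div_cancel_right) simp
  finally show ?thesis .
qed (auto simp: qbinom_def pascal_eq_0)

definition qb :: "nat \<Rightarrow> int \<Rightarrow> int fls" where
  "qb n k = fps_to_fls (fps_of_poly (qbinom (int n) k))"

lemma qb_0: "qb 0 k = (if k = 0 then 1 else 0)"
  using qbinom_eq_pascal[of 0 k] by (simp add: qb_def)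

lemma qb_eq_0: "k < 0 \<or> int n < k \<Longrightarrow> qb n k = 0"
  by (simp add: qb_def qbinom_eq_pascal pascal_eq_0)

lemma qb_Suc: "qb (Suc n) k = Q k * qb n k + qb n (k - 1)"
proof (cases "0 \<le> k")
  case True
  then show ?thesis
    unfolding qb_def qbinom_eq_pascal
    by (simp add: fls_times_fps_to_fls fps_of_poly_mult fps_of_poly_add Q_of_monom)
qed (simp add: qb_eq_0)

lemma qb_sym: "qb n (int n - k) = qb n k"
proof (cases "0 \<le> k \<and> k \<le> int n")
  case True
  then show ?thesis
    by (simp add: qb_def qbinom_def mult.commute)
next
  case False
  then have "k < 0 \<or> int n < k" "int n - k < 0 \<or> int n < int n - k"
    by auto
  then show ?thesis
    by (metis qb_eq_0)
qed

text \<open>The second Pascal rule is the first one under the reflection of \<open>k\<close> to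
  \<open>n + 1 - k\<close>.\<close>

lemma qb_Suc': "qb (Suc n) k = qb n k + Q (int n + 1 - k) * qb n (k - 1)"
  using qb_Suc[of n "int (Suc n) - k"] qb_sym[of "Suc n" k] qb_sym[of n k] qb_sym[of n "k - 1"]
  by (simp add: algebra_simps)

text \<open>Both sides are the q-multinomial coefficient with parts \<open>a\<close>,
  \<open>b\<close>, \<open>k\<close>, \<open>l\<close>, grouped as {a, k}, {b, l} on the left and as
  {a, b}, {k, l} on the right.\<close>

lemma qb_multinomial:
  "qb (a + k + (b + l)) (int (a + k)) * (qb (a + k) (int k) * qb (b + l) (int b)) =
   qb (a + b + (k + l)) (int (a + b)) * (qb (a + b) (int a) * qb (k + l) (int k))"
proof -
  let ?F = "qpoch"
  have A: "pascal (a + k + (b + l)) (int (a + k)) * (pascal (a + k) (int k) * pascal (b + l) (int b))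
     * (?F a * ?F b * ?F k * ?F l) = ?F (a + b + k + l)"
  proof -
    have "pascal (a + k + (b + l)) (int (a + k)) * (pascal (a + k) (int k) * pascal (b + l) (int b))
     * (?F a * ?F b * ?F k * ?F l) = pascal (a + k + (b + l)) (int (a + k)) *
       ((pascal (a + k) (int k) * (?F k * ?F a)) * (pascal (b + l) (int b) * (?F b * ?F l)))"
      by (simp add: mult_ac)
    also have "\<dots> = ?F (a + k + (b + l))"
      using pascal_mult_qpoch[of k a] pascal_mult_qpoch[of "a + k" "b + l"]
      by (simp only: pascal_mult_qpoch add.commute[of k a])
    finally show ?thesis by (simp add: add_ac)
  qed
  have B: "pascal (a + b + (k + l)) (int (a + b)) * (pascal (a + b) (int a) * pascal (k + l) (int k))
     * (?F a * ?F b * ?F k * ?F l) = ?F (a + b + k + l)"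
  proof -
    have "pascal (a + b + (k + l)) (int (a + b)) * (pascal (a + b) (int a) * pascal (k + l) (int k))
     * (?F a * ?F b * ?F k * ?F l) = pascal (a + b + (k + l)) (int (a + b)) *
       ((pascal (a + b) (int a) * (?F a * ?F b)) * (pascal (k + l) (int k) * (?F k * ?F l)))"
      by (simp add: mult_ac)
    also have "\<dots> = ?F (a + b + (k + l))"
      unfolding pascal_mult_qpoch by simp
    finally show ?thesis by (simp add: add_ac)
  qed
  have nz: "?F a * ?F b * ?F k * ?F l \<noteq> 0" by simp
  have "pascal (a + k + (b + l)) (int (a + k)) * (pascal (a + k) (int k) * pascal (b + l) (int b))
    = pascal (a + b + (k + l)) (int (a + b)) * (pascal (a + b) (int a) * pascal (k + l) (int k))"
    using A B nz by (metis mult_right_cancel)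
  then show ?thesis
    unfolding qb_def qbinom_eq_pascal
    by (metis (mono_tags, lifting) fls_times_fps_to_fls fps_of_poly_mult)
qed

section \<open>q-Vandermonde convolution and the two kernel expansions\<close>

lemma q_vandermonde:
  "qb (m + n) k = (\<Sum>j=0..int n. Q (j * (int m - k + j)) * (qb m (k - j) * qb n j))"
proof (induction m arbitrary: k)
  case 0
  have eq: "Q (j * (int 0 - k + j)) * (qb 0 (k - j) * qb n j) = (if j = k then qb n j else 0)" for j
    by (simp add: qb_0)
  show ?case
  proof (cases "k \<in> {0..int n}")
    case False
    then have "qb n k = 0"
      by (intro qb_eq_0) auto
    with False show ?thesis
      unfolding eq by simp
  next
    case True
    then show ?thesis
      unfolding eq by simp
  qed
next
  case (Suc m)
  have "Q (j * (int (Suc m) - k + j)) * (qb (Suc m) (k - j) * qb n j) =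
     Q k * (Q (j * (int m - k + j)) * (qb m (k - j) * qb n j))
     + Q (j * (int m - (k - 1) + j)) * (qb m (k - 1 - j) * qb n j)" for j
  proof -
    have 1: "Q (j * (int (Suc m) - k + j)) * Q (k - j) = Q k * Q (j * (int m - k + j))"
      unfolding Q_add[symmetric] by (simp add: algebra_simps)
    have 2: "k - j - 1 = k - 1 - j" and 3: "int m - (k - 1) + j = int (Suc m) - k + j"
      by simp_all
    have "A * ((B * x + y) * z) = C * (D * (x * z)) + A * (y * z)" if "A * B = C * D" for A B C D x y z :: "int fls"
      using that by (simp add: distrib_left distrib_right mult.assoc[symmetric])
    from this[OF 1] show ?thesis
      unfolding qb_Suc[of m "k - j"] 2 3 .
  qed
  then have "(\<Sum>j=0..int n. Q (j * (int (Suc m) - k + j)) * (qb (Suc m) (k - j) * qb n j)) =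
     Q k * qb (m + n) k + qb (m + n) (k - 1)"
    unfolding Suc sum_distrib_left sum.distrib[symmetric] by (intro sum.cong refl)
  then show ?case
    unfolding add_Suc qb_Suc[of "m + n" k] by simp
qed

text \<open>The second argument is twice the offset from the centre of the \<open>q\<close>-binomial row, so that it
  stays an integer for rows of either parity.\<close>

definition qbc :: "nat \<Rightarrow> int \<Rightarrow> int fls" where
  "qbc m x = (if even (int m - x) then qb m ((int m - x) div 2) else 0)"

text \<open>A second convolution splits row \<open>L\<close> of the factor
  \<open>qb L (s + v)\<close> into rows \<open>s\<close> and \<open>L - s\<close>; the three
  q-binomials are then regrouped as a q-multinomial. The weight \<open>\<phi>\<close> stays
  arbitrary because several different powers of q are inserted for it later.\<close>

lemma qb_square_expand:
  "(\<Sum>s=0..int L. \<phi> s * (qb L s * qb L (s + v))) =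
   (\<Sum>m=0..int L. qb L m * (\<Sum>k=0..int L - m. Q ((m - v) div 2 * ((m + v) div 2))
       * \<phi> ((m - v) div 2 + k) * qb (L - nat m) k) * qbc (nat m) v)"
    (is "?lhs = ?rhs")
proof -
  define g where "g = (\<lambda>(s, b). \<phi> s * (Q (b * (b - v)) *
      (qb L s * (qb (nat s) (s + v - b) * qb (L - nat s) b))))"
  define h where "h = (\<lambda>(m, k). qb L m * (Q ((m - v) div 2 * ((m + v) div 2))
       * \<phi> ((m - v) div 2 + k) * qb (L - nat m) k) * qbc (nat m) v)"
  let ?S = "SIGMA s:{0..int L}. {0..int L - s}"
  let ?S1 = "{(s, b) \<in> ?S. 0 \<le> s + v - b \<and> s + v - b \<le> s}"
  let ?T1 = "{(m, k) \<in> ?S. even (m - v) \<and> 0 \<le> (m - v) div 2 \<and> (m - v) div 2 \<le> m}"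
  have "?lhs = (\<Sum>s=0..int L. \<Sum>b=0..int L - s. g (s, b))"
  proof (rule sum.cong[OF refl])
    fix s assume s: "s \<in> {0..int L}"
    define s' where "s' = nat s"
    have s': "s = int s'" "s' \<le> L" using s by (auto simp: s'_def)
    have "qb L (s + v) = (\<Sum>b=0..int (L - s'). Q (b * (s - (s + v) + b)) * (qb s' (s + v - b) * qb (L - s') b))"
      using q_vandermonde[of s' "L - s'" "s + v"] s' by simp
    then show "\<phi> s * (qb L s * qb L (s + v)) = (\<Sum>b=0..int L - s. g (s, b))"
      using s' by (simp add: g_def sum_distrib_left mult_ac of_nat_diff)
  qed
  also have "\<dots> = sum g ?S"
    by (subst sum.Sigma) auto
  also have "\<dots> = sum g ?S1"
  proof (rule sum.mono_neutral_right)
    show "\<forall>z\<in>?S - ?S1. g z = 0"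
    proof
      fix z assume "z \<in> ?S - ?S1"
      moreover obtain s b where "z = (s, b)" by (cases z)
      ultimately have z: "z = (s, b)" "s + v - b < 0 \<or> int (nat s) < s + v - b" by auto
      show "g z = 0"
        using qb_eq_0[OF z(2)] by (simp add: g_def z(1))
    qed
  qed auto
  \<comment> \<open>With a = b - v and k = s + v - b, the new index is m = a + b = 2 b - v, so a and
    b are (m - v)/2 and (m + v)/2, and s = a + k. This is a bijection only between the ranges
    \<open>?S1\<close> and \<open>?T1\<close>, outside which the terms vanish.\<close>
  also have "\<dots> = sum h ?T1"
  proof (rule sum.reindex_bij_witness[where
        i = "\<lambda>(m, k). (k + (m - v) div 2, (m + v) div 2)" and
        j = "\<lambda>(s, b). (2 * b - v, s + v - b)"])
    fix z assume "z \<in> ?S1"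
    then obtain s b where z: "z = (s, b)" "0 \<le> b" "s + b \<le> int L" "0 \<le> s + v - b" "v \<le> b"
      by auto
    then show "(case case z of (s, b) \<Rightarrow> (2 * b - v, s + v - b) of
        (m, k) \<Rightarrow> (k + (m - v) div 2, (m + v) div 2)) = z" 
      by simp
    show "(case z of (s, b) \<Rightarrow> (2 * b - v, s + v - b)) \<in>
      ?T1"
      using z(2-5) unfolding z(1) prod.case by auto
    define a k l b' where "a = nat (b - v)" and "k = nat (s + v - b)" and "l = nat (int L - s - b)" and "b' = nat b"
    have eqs: "b = int b'" "s = int (a + k)" "v = int b' - int a" "L = a + k + (b' + l)"
      using z by (auto simp: a_def k_def l_def b'_def)
    have eqs': "L = a + b' + (k + l)" using eqs(4) by simp
    have d: "L - (a + k) = b' + l" "L - (a + b') = k + l" using eqs(4) by auto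
    have m: "2 * b - v = int (a + b')" and k: "s + v - b = int k" and "b - v = int a"
      using eqs by auto
    have par: "(int (a + b') - v) div 2 = int a" "(int (a + b') + v) div 2 = int b'" "even (int (a + b') - v)"
      using eqs(3) by auto
    have M: "qb L (int (a + k)) * (qb (a + k) (int k) * qb (b' + l) (int b')) =
      qb L (int (a + b')) * (qb (a + b') (int a) * qb (k + l) (int k))"
      using qb_multinomial[of a k b' l] unfolding eqs(4)[symmetric] eqs'[symmetric] .
    have "g (s, b) = \<phi> (int (a + k)) * (Q (int b' * int a) *
         (qb L (int (a + k)) * (qb (a + k) (int k) * qb (b' + l) (int b'))))"
    proof -
      have n: "nat s = a + k" "L - nat s = b' + l" "s = int (a + k)"
        using eqs(2) d(1) by simp_all
      show ?thesis
        unfolding g_def prod.case k \<open>b - v = int a\<close> n(1) n(2) unfolding d(1) n(3) eqs(1) by (rule refl)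
    qed
    moreover have "h (2 * b - v, s + v - b) = qb L (int (a + b')) * (Q (int a * int b')
        * \<phi> (int a + int k) * qb (k + l) (int k)) * qb (a + b') (int a)"
      unfolding h_def prod.case k m par nat_int d qbc_def using par(3) by simp
    ultimately show "h (case z of (s, b) \<Rightarrow> (2 * b - v, s + v - b)) = g z"
      unfolding z(1) prod.case M by (simp add: mult_ac)
  next
    fix z assume "z \<in> ?T1"
    then obtain m k where z: "z = (m, k)" "0 \<le> k" "m + k \<le> int L" "even (m - v)" "0 \<le> (m - v) div 2" "(m - v) div 2 \<le> m"
      by auto
    from z(4) obtain a where a: "m - v = 2 * a" by blast
    then have v: "v = m - 2 * a" by simp
    have d: "(m - v) div 2 = a" "(m + v) div 2 = m - a" unfolding v by simp_all
    show "(case case z of (m, k) \<Rightarrow> (k + (m - v) div 2, (m + v) div 2) of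
         (s, b) \<Rightarrow> (2 * b - v, s + v - b)) = z"
      unfolding z(1) prod.case d by (simp add: v)
    show "(case z of (m, k) \<Rightarrow> (k + (m - v) div 2, (m + v) div 2))
         \<in> ?S1"
      using z(2,3,5,6) unfolding z(1) prod.case d by (auto simp: v)
  qed
  also have "\<dots> = sum h ?S"
  proof (rule sum.mono_neutral_left)
    show "\<forall>z\<in>?S - ?T1. h z = 0"
    proof
      fix z assume "z \<in> ?S - ?T1"
      moreover obtain m k where "z = (m, k)" by (cases z)
      ultimately have z: "z = (m, k)" "0 \<le> m" "odd (m - v) \<or> ((m - v) div 2 < 0 \<or> int (nat m) < (m - v) div 2)" by auto
      have "qbc (nat m) v = 0"
        using z(2,3) qb_eq_0[of "(m - v) div 2" "nat m"] by (auto simp: qbc_def)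
      then show "h z = 0"
        by (simp add: h_def z(1))
    qed
  qed auto
  also have "\<dots> = (\<Sum>m=0..int L. \<Sum>k=0..int L - m. h (m, k))"
    by (subst sum.Sigma) auto
  also have "\<dots> = ?rhs"
    by (simp add: h_def sum_distrib_left sum_distrib_right)
  finally show ?thesis .
qed

text \<open>The expansion coefficients: \<open>d = 1\<close> for rows of odd length and
  \<open>d = 0\<close> for rows of even length. They do not depend on the offset \<open>v\<close>,
  so one kernel serves all terms of a sum at once.\<close>

definition kern :: "int \<Rightarrow> nat \<Rightarrow> int \<Rightarrow> int fls" where
  "kern d L m = Q (m * (m + d) div 2) *
     (qb L m * (\<Sum>k=0..int L - m. Q (k * (k + m + d)) * qb (L - nat m) k))"

text \<open>Used with \<open>c\<close>, \<open>X\<close> powers of q that involve \<open>v\<close>,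
  and \<open>d\<close>, \<open>Y\<close> powers free of \<open>v\<close>: the prefactor absorbs all
  dependence on \<open>v\<close> outside the last factor.\<close>

lemma sum_exchange_factor:
  fixes c d l z :: "'a :: comm_ring_1"
  assumes "\<And>k. c * X k = d * Y k"
  shows "c * (l * (\<Sum>k\<in>K. X k * w k) * z) = d * (l * (\<Sum>k\<in>K. Y k * w k)) * z"
proof -
  have "c * (\<Sum>k\<in>K. X k * w k) = (\<Sum>k\<in>K. (c * X k) * w k)"
    by (simp add: sum_distrib_left mult.assoc)
  also have "\<dots> = d * (\<Sum>k\<in>K. Y k * w k)"
    unfolding assms by (simp add: sum_distrib_left mult.assoc)
  finally show ?thesis
    by (metis mult.assoc mult.left_commute)
qed

text \<open>Row \<open>2 * L\<close> is convolved from two rows \<open>L\<close>, and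
  \<open>qb_square_expand\<close> is applied. With m = v + 2 a, multiplying by the prefactor
  completes the square: the total exponent becomes \<open>m * m div 2 + k * (k + m)\<close>.\<close>

lemma qb_even_transform:
  "Q (v * v div 2) * qb (2 * L) (int L - v) = (\<Sum>m=0..int L. kern 0 L m * qbc (nat m) v)"
proof -
  have "Q (v * v div 2) * qb (2 * L) (int L - v) =
     Q (v * v div 2) * (\<Sum>s=0..int L. Q (s * (s + v)) * (qb L s * qb L (s + v)))"
  proof -
    have "qb L (int L - v - s) = qb L (s + v)" for s
      using qb_sym[of L "s + v"] by (simp add: algebra_simps)
    then show ?thesis
      using q_vandermonde[of L L "int L - v"] by (simp add: mult_2_right algebra_simps)
  qed
  also have "\<dots> = (\<Sum>m=0..int L. kern 0 L m * qbc (nat m) v)"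
    unfolding qb_square_expand sum_distrib_left[of "Q (v * v div 2)"]
  proof (rule sum.cong[OF refl])
    fix m assume m: "m \<in> {0..int L}"
    show "Q (v * v div 2) * (qb L m * (\<Sum>k=0..int L - m. Q ((m - v) div 2 * ((m + v) div 2)) *
        Q (((m - v) div 2 + k) * ((m - v) div 2 + k + v)) * qb (L - nat m) k) * qbc (nat m) v) =
        kern 0 L m * qbc (nat m) v"
    proof (cases "even (m - v)")
      case True
      then obtain a where "m - v = 2 * a" by blast
      then have mv: "m = v + 2 * a" by simp
      have "m * m = v * v + 2 * (2 * a * (a + v))" by (simp add: mv algebra_simps)
      then have sq: "m * m div 2 = v * v div 2 + 2 * a * (a + v)" by simp
      have d: "(m - v) div 2 = a" "(m + v) div 2 = a + v" unfolding mv by simp_all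
      have "Q (v * v div 2) * (Q (a * (a + v)) * Q ((a + k) * (a + k + v))) = Q (m * m div 2) * Q (k * (k + m))" for k
        unfolding Q_add[symmetric] sq by (rule arg_cong[of _ _ Q]) (simp add: mv algebra_simps)
      then show ?thesis
        unfolding d kern_def add_0_right by (rule sum_exchange_factor)
    next
      case False
      then show ?thesis using m by (simp add: qbc_def)
    qed
  qed
  finally show ?thesis .
qed

text \<open>Row \<open>2 * L + 1\<close> is convolved from rows \<open>L + 1\<close> and
  \<open>L\<close>, and a Pascal rule splits row \<open>L + 1\<close> into two sums with offsets
  \<open>v\<close> and \<open>v + 1\<close>. They contribute for opposite parities of
  \<open>m\<close>, with the same kernel, and \<open>(m - v) div 2\<close> covers both
  cases.\<close>

lemma qb_odd_transform:
  "Q (v * (v + 1) div 2) * qb (2 * L + 1) (int L - v) =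
   (\<Sum>m=0..int L. kern 1 L m * qb (nat m) ((m - v) div 2))"
proof -
  define f1 where "f1 m = Q (v * (v + 1) div 2) * (qb L m * (\<Sum>k=0..int L - m. Q ((m - v) div 2 * ((m + v) div 2)) *
        Q (((m - v) div 2 + k) * ((m - v) div 2 + k + v + 1)) * qb (L - nat m) k) * qbc (nat m) v)" for m
  define f2 where "f2 m = Q (v * (v + 1) div 2) * (qb L m * (\<Sum>k=0..int L - m. Q ((m - (v + 1)) div 2 * ((m + (v + 1)) div 2)) *
        Q (((m - (v + 1)) div 2 + k + 1) * ((m - (v + 1)) div 2 + k + v + 1)) * qb (L - nat m) k) * qbc (nat m) (v + 1))" for m
  have "qb (2 * L + 1) (int L - v) = (\<Sum>s=0..int L. Q (s * (s + v + 1)) * (qb L s * qb (Suc L) (s + v + 1)))"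
  proof -
    have "qb (Suc L) (int L - v - s) = qb (Suc L) (s + v + 1)" for s
      using qb_sym[of "Suc L" "s + v + 1"] by (simp add: algebra_simps)
    then show ?thesis
      using q_vandermonde[of "Suc L" L "int L - v"] by (simp add: mult_2_right algebra_simps)
  qed
  also have "\<dots> = (\<Sum>s=0..int L. Q (s * (s + v + 1)) * (qb L s * qb L (s + v)))
     + (\<Sum>s=0..int L. Q ((s + 1) * (s + v + 1)) * (qb L s * qb L (s + (v + 1))))"
  proof -
    have "Q (s * (s + v + 1)) * Q (s + v + 1) = Q ((s + 1) * (s + v + 1))" for s
      unfolding Q_add[symmetric] by (simp add: algebra_simps)
    moreover have "A * (x * (B * y + z)) = A * (x * z) + C * (x * y)" if "A * B = C" for A B C x y z :: "int fls"
      using that by (auto simp: algebra_simps)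
    ultimately have "Q (s * (s + v + 1)) * (qb L s * (Q (s + v + 1) * qb L (s + v + 1) + qb L (s + v))) =
      Q (s * (s + v + 1)) * (qb L s * qb L (s + v)) + Q ((s + 1) * (s + v + 1)) * (qb L s * qb L (s + v + 1))" for s
      by blast
    then show ?thesis
      unfolding qb_Suc sum.distrib[symmetric] add.assoc[symmetric] by simp
  qed
  finally have "Q (v * (v + 1) div 2) * qb (2 * L + 1) (int L - v) = (\<Sum>m=0..int L. f1 m + f2 m)"
    unfolding qb_square_expand by (simp add: f1_def f2_def distrib_left sum_distrib_left sum.distrib)
  also have "\<dots> = (\<Sum>m=0..int L. kern 1 L m * qb (nat m) ((m - v) div 2))"
  proof (rule sum.cong[OF refl])
    fix m assume m: "m \<in> {0..int L}"
    show "f1 m + f2 m = kern 1 L m * qb (nat m) ((m - v) div 2)"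
    proof (cases "even (m - v)")
      case True
      then obtain a where "m - v = 2 * a" by blast
      then have mv: "m = v + 2 * a" by simp
      have "m * (m + 1) = v * (v + 1) + 2 * (a * (2 * a + 2 * v + 1))" by (simp add: mv algebra_simps)
      then have sq: "m * (m + 1) div 2 = v * (v + 1) div 2 + a * (2 * a + 2 * v + 1)" by simp
      have d: "(m - v) div 2 = a" "(m + v) div 2 = a + v" unfolding mv by simp_all
      have "Q (v * (v + 1) div 2) * (Q (a * (a + v)) * Q ((a + k) * (a + k + v + 1))) = Q (m * (m + 1) div 2) * Q (k * (k + m + 1))" for k
        unfolding Q_add[symmetric] sq by (rule arg_cong[of _ _ Q]) (simp add: mv algebra_simps)
      note e = sum_exchange_factor[OF this]
      have "qbc (nat m) v = qb (nat m) a" "qbc (nat m) (v + 1) = 0"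
        using m True d by (auto simp: qbc_def)
      then show ?thesis
        unfolding d kern_def f1_def f2_def e by simp
    next
      case False
      then have "even (m - (v + 1))" by simp
      then obtain a where "m - (v + 1) = 2 * a" by blast
      then have mv: "m = v + 1 + 2 * a" by simp
      have "m * (m + 1) = v * (v + 1) + 2 * ((a + v + 1) * (2 * a + 1))" by (simp add: mv algebra_simps)
      then have sq: "m * (m + 1) div 2 = v * (v + 1) div 2 + (a + v + 1) * (2 * a + 1)" by simp
      have d: "(m - (v + 1)) div 2 = a" "(m + (v + 1)) div 2 = a + (v + 1)" "(m - v) div 2 = a" unfolding mv by simp_all
      have "Q (v * (v + 1) div 2) * (Q (a * (a + (v + 1))) * Q ((a + k + 1) * (a + k + v + 1))) = Q (m * (m + 1) div 2) * Q (k * (k + m + 1))" for k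
        unfolding Q_add[symmetric] sq by (rule arg_cong[of _ _ Q]) (simp add: mv algebra_simps)
      note e = sum_exchange_factor[OF this]
      have "qbc (nat m) (v + 1) = qb (nat m) a" "qbc (nat m) v = 0"
        using m False d by (auto simp: qbc_def)
      then show ?thesis
        unfolding d kern_def f1_def f2_def e by simp
    qed
  qed
  finally show ?thesis .
qed

section \<open>Laurent series with non-negative coefficients\<close>

definition nonneg :: "int fls \<Rightarrow> bool" where
  "nonneg f \<longleftrightarrow> (\<forall>e. fls_nth f e \<ge> 0)"

lemma nonneg_0 [simp]: "nonneg 0" and nonneg_1 [simp]: "nonneg 1"
  by (simp_all add: nonneg_def)

lemma nonneg_add: "nonneg f \<Longrightarrow> nonneg g \<Longrightarrow> nonneg (f + g)"
  by (simp add: nonneg_def)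

lemma nonneg_sum: "(\<And>x. x \<in> A \<Longrightarrow> nonneg (f x)) \<Longrightarrow> nonneg (sum f A)"
  by (induction A rule: infinite_finite_induct) (auto intro: nonneg_add)

lemma nonneg_mult: "nonneg f \<Longrightarrow> nonneg g \<Longrightarrow> nonneg (f * g)"
  by (simp add: nonneg_def fls_times_nth(1) sum_nonneg)

lemma nonneg_Q [simp]: "nonneg (Q k)"
  by (simp add: nonneg_def Q_def)

lemma nonneg_Q_mult_iff: "nonneg (Q k * f) \<longleftrightarrow> nonneg f"
  unfolding nonneg_def Q_mult_nth by (metis add_diff_cancel_right')

lemma nonneg_qb: "nonneg (qb n k)"
  by (induction n arbitrary: k) (auto simp: qb_0 qb_Suc intro!: nonneg_add nonneg_mult)

lemma nonneg_kern: "nonneg (kern d L m)"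
  by (auto simp: kern_def intro!: nonneg_mult nonneg_sum nonneg_qb)

section \<open>Pascal recurrences and positivity for integer parameters\<close>

text \<open>\<open>D_{K,i}(n - M, M; \<alpha>, \<beta>)\<close> with \<open>j\<close> cut off at \<open>J\<close>, so that the recurrences below need no
  side conditions. The cut-off is invisible only for large \<open>J\<close>, hence the \<open>eventually\<close>.\<close>

definition hook_sum :: "int \<Rightarrow> int \<Rightarrow> int \<Rightarrow> int \<Rightarrow> nat \<Rightarrow> int \<Rightarrow> int \<Rightarrow> int fls" where
  "hook_sum K i \<alpha> \<beta> n M J = (\<Sum>j=-J..J.
     Q (j * ((\<alpha> + \<beta>) * K * j + K * \<beta> - (\<alpha> + \<beta>) * i)) * qb n (M - K * j)
     - Q (((\<alpha> + \<beta>) * j + \<beta>) * (K * j + i)) * qb n (M - K * j - i))"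

text \<open>The second Pascal rule, termwise. Its power of q is \<open>Q (int n + 1 - M)\<close>
  times a factor depending on \<open>j\<close> that raises \<beta> by 1 at fixed \<alpha> + \<beta>,
  in both families of terms. The first summand lowers N, the second lowers M.\<close>

lemma hook_sum_rec_N:
  "hook_sum K i \<alpha> \<beta> (Suc n) M J = hook_sum K i \<alpha> \<beta> n M J
     + Q (int n + 1 - M) * hook_sum K i (\<alpha> - 1) (\<beta> + 1) n (M - 1) J"
  unfolding hook_sum_def sum_distrib_left sum.distrib[symmetric]
proof (rule sum.cong[OF refl])
  fix j
  let ?g = "\<alpha> + \<beta>"
  have g: "\<alpha> - 1 + (\<beta> + 1) = ?g" by simp
  have e: "Q (j * (?g * K * j + K * \<beta> - ?g * i)) * Q (int n + 1 - (M - K * j)) =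
      Q (int n + 1 - M) * Q (j * (?g * K * j + K * (\<beta> + 1) - ?g * i))"
    "Q ((?g * j + \<beta>) * (K * j + i)) * Q (int n + 1 - (M - K * j - i)) =
      Q (int n + 1 - M) * Q ((?g * j + (\<beta> + 1)) * (K * j + i))"
    unfolding Q_add[symmetric] by (simp_all add: algebra_simps)
  have m: "M - K * j - 1 = M - 1 - K * j" "M - K * j - i - 1 = M - 1 - K * j - i" by simp_all
  have "A * (x + B * y) - A' * (x' + B' * y') = A * x - A' * x' + C * (D * y - D' * y')"
    if "A * B = C * D" "A' * B' = C * D'" for A B C D A' B' D' x y x' y' :: "int fls"
  proof -
    have "A * (B * y) = C * (D * y)" "A' * (B' * y') = C * (D' * y')"
      using that by (simp_all only: mult.assoc[symmetric])
    then show ?thesis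
      by (simp only: distrib_left right_diff_distrib) simp
  qed
  from this[OF e]
  show "Q (j * (?g * K * j + K * \<beta> - ?g * i)) * qb (Suc n) (M - K * j)
       - Q ((?g * j + \<beta>) * (K * j + i)) * qb (Suc n) (M - K * j - i) =
     Q (j * (?g * K * j + K * \<beta> - ?g * i)) * qb n (M - K * j)
       - Q ((?g * j + \<beta>) * (K * j + i)) * qb n (M - K * j - i) +
     Q (int n + 1 - M) *
       (Q (j * ((\<alpha> - 1 + (\<beta> + 1)) * K * j + K * (\<beta> + 1) - (\<alpha> - 1 + (\<beta> + 1)) * i)) * qb n (M - 1 - K * j)
       - Q (((\<alpha> - 1 + (\<beta> + 1)) * j + (\<beta> + 1)) * (K * j + i)) * qb n (M - 1 - K * j - i))"
    unfolding qb_Suc'[of n "M - K * j"] qb_Suc'[of n "M - K * j - i"] m g .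
qed

text \<open>The first Pascal rule, termwise: here the power of q lowers \<beta> by 1 and raises
  \<alpha>. The first summand lowers M, the second lowers N.\<close>

lemma hook_sum_rec_M:
  "hook_sum K i \<alpha> \<beta> (Suc n) M J = hook_sum K i \<alpha> \<beta> n (M - 1) J
     + Q M * hook_sum K i (\<alpha> + 1) (\<beta> - 1) n M J"
  unfolding hook_sum_def sum_distrib_left sum.distrib[symmetric]
proof (rule sum.cong[OF refl])
  fix j
  let ?g = "\<alpha> + \<beta>"
  have g: "\<alpha> + 1 + (\<beta> - 1) = ?g" by simp
  have e: "Q (j * (?g * K * j + K * \<beta> - ?g * i)) * Q (M - K * j) =
      Q M * Q (j * (?g * K * j + K * (\<beta> - 1) - ?g * i))"
    "Q ((?g * j + \<beta>) * (K * j + i)) * Q (M - K * j - i) =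
      Q M * Q ((?g * j + (\<beta> - 1)) * (K * j + i))"
    unfolding Q_add[symmetric] by (simp_all add: algebra_simps)
  have m: "M - K * j - 1 = M - 1 - K * j" "M - K * j - i - 1 = M - 1 - K * j - i" by simp_all
  have "A * (B * y + x) - A' * (B' * y' + x') = A * x - A' * x' + C * (D * y - D' * y')"
    if "A * B = C * D" "A' * B' = C * D'" for A B C D A' B' D' x y x' y' :: "int fls"
  proof -
    have "A * (B * y) = C * (D * y)" "A' * (B' * y') = C * (D' * y')"
      using that by (simp_all only: mult.assoc[symmetric])
    then show ?thesis
      by (simp only: distrib_left right_diff_distrib) simp
  qed
  from this[OF e]
  show "Q (j * (?g * K * j + K * \<beta> - ?g * i)) * qb (Suc n) (M - K * j)
       - Q ((?g * j + \<beta>) * (K * j + i)) * qb (Suc n) (M - K * j - i) =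
     Q (j * (?g * K * j + K * \<beta> - ?g * i)) * qb n (M - 1 - K * j)
       - Q ((?g * j + \<beta>) * (K * j + i)) * qb n (M - 1 - K * j - i) +
     Q M *
       (Q (j * ((\<alpha> + 1 + (\<beta> - 1)) * K * j + K * (\<beta> - 1) - (\<alpha> + 1 + (\<beta> - 1)) * i)) * qb n (M - K * j)
       - Q (((\<alpha> + 1 + (\<beta> - 1)) * j + (\<beta> - 1)) * (K * j + i)) * qb n (M - K * j - i))"
    unfolding qb_Suc[of n "M - K * j"] qb_Suc[of n "M - K * j - i"] m g .
qed

text \<open>For \<open>\<beta> = 0\<close> or \<open>\<alpha> = 0\<close> at the extreme value of \<open>N - M\<close> neither recurrence stays in the admissible
  range, but there the reflections \<open>j \<mapsto> -j\<close> and \<open>j \<mapsto> -1 - j\<close> cancel the two sums.\<close>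

lemma hook_sum_boundary_\<beta>:
  assumes "int n - 2 * M = - i"
  shows "hook_sum K i \<alpha> 0 n M J = 0"
proof -
  define F where "F j = Q (j * (\<alpha> * K * j - \<alpha> * i)) * qb n (M - K * j)" for j
  have "Q (\<alpha> * j * (K * j + i)) * qb n (M - K * j - i) = F (- j)" for j
  proof -
    have "int n - (M + K * j) = M - K * j - i"
      using assms by simp
    then have "qb n (M + K * j) = qb n (M - K * j - i)"
      by (metis qb_sym)
    moreover have "\<alpha> * j * (K * j + i) = - j * (\<alpha> * K * - j - \<alpha> * i)"
      by (simp add: algebra_simps)
    ultimately show ?thesis
      by (simp add: F_def)
  qed
  then have "hook_sum K i \<alpha> 0 n M J = (\<Sum>j=-J..J. F j) - (\<Sum>j=-J..J. F (- j))"
    by (simp add: hook_sum_def F_def sum_subtractf)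
  also have "(\<Sum>j=-J..J. F (- j)) = (\<Sum>j=-J..J. F j)"
    by (rule sum.reindex_bij_witness[of _ uminus uminus]) auto
  finally show ?thesis by simp
qed

lemma hook_sum_boundary_\<alpha>:
  assumes d: "int n - 2 * M = K - i" and "K > 0" and J: "J > int n + \<bar>M\<bar>"
  shows "hook_sum K i 0 \<beta> n M J = 0"
proof -
  define F where "F j = Q (j * (\<beta> * K * j + K * \<beta> - \<beta> * i)) * qb n (M - K * j)" for j
  have "Q ((\<beta> * j + \<beta>) * (K * j + i)) * qb n (M - K * j - i) = F (- 1 - j)" for j
  proof -
    have "int n - (M - K * (- 1 - j)) = M - K * j - i"
      using d by (simp add: algebra_simps)
    then have "qb n (M - K * (- 1 - j)) = qb n (M - K * j - i)"
      by (metis qb_sym)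
    moreover have "(\<beta> * j + \<beta>) * (K * j + i) = (- 1 - j) * (\<beta> * K * (- 1 - j) + K * \<beta> - \<beta> * i)"
      by (simp add: algebra_simps)
    ultimately show ?thesis
      by (simp add: F_def)
  qed
  then have "hook_sum K i 0 \<beta> n M J = (\<Sum>j=-J..J. F j) - (\<Sum>j=-J..J. F (- 1 - j))"
    by (simp add: hook_sum_def F_def sum_subtractf)
  \<comment> \<open>The reflection shifts the range by one; the terms at \<open>- J - 1\<close> and
    at \<open>J\<close>, where the ranges differ, vanish because \<open>J\<close> is large.\<close>
  also have "(\<Sum>j=-J..J. F (- 1 - j)) = (\<Sum>j=-J-1..J-1. F j)"
    by (rule sum.reindex_bij_witness[of _ "\<lambda>j. - 1 - j" "\<lambda>j. - 1 - j"]) auto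
  also have "\<dots> = (\<Sum>j=-J..J-1. F j)"
  proof (rule sum.mono_neutral_right)
    have "K * (J + 1) \<ge> J + 1"
      using mult_right_mono[of 1 K "J + 1"] \<open>K > 0\<close> J by simp
    then have "M - K * (- J - 1) > int n"
      using J by (simp add: algebra_simps)
    then have "F (- J - 1) = 0"
      by (simp add: F_def qb_eq_0)
    moreover have "{-J-1..J-1} - {-J..J-1} \<subseteq> {-J-1}" by auto
    ultimately show "\<forall>j\<in>{-J-1..J-1} - {-J..J-1}. F j = 0"
      by blast
  qed auto
  also have "\<dots> = (\<Sum>j=-J..J. F j)"
  proof (rule sum.mono_neutral_left)
    have "K * J \<ge> J"
      using mult_right_mono[of 1 K J] \<open>K > 0\<close> J by simp
    then have "M - K * J < 0"
      using J by simp
    then have "F J = 0"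
      by (simp add: F_def qb_eq_0)
    moreover have "{-J..J} - {-J..J-1} \<subseteq> {J}" by auto
    ultimately show "\<forall>j\<in>{-J..J} - {-J..J-1}. F j = 0"
      by blast
  qed auto
  finally show ?thesis by simp
qed

text \<open>Induction on the row length. Whenever \<open>hook_sum_rec_N\<close> is used with
  \<alpha> > 0 and N - M above its lower bound, or \<open>hook_sum_rec_M\<close> with \<beta> > 0
  and N - M below its upper bound, both smaller sums again satisfy the bounds.\<close>

lemma hook_sum_nonneg:
  assumes "0 < i" "i < K" "0 \<le> \<alpha>" "0 \<le> \<beta>" "0 < \<alpha> + \<beta>" "\<alpha> + \<beta> < K"
    and "\<beta> - i \<le> int n - 2 * M" "int n - 2 * M \<le> K - i - \<alpha>"
  shows "\<forall>\<^sub>F J in at_top. nonneg (hook_sum K i \<alpha> \<beta> n M J)"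
  using assms(3-)
proof (induction n arbitrary: \<alpha> \<beta> M)
  case 0
  \<comment> \<open>No subtracted term survives: M = K j + i is excluded for j \<ge> 0 by -2 M \<ge>
    -i and for j \<le> -1 by -2 M \<le> K - i.\<close>
  have "qb 0 (M - K * j - i) = 0" for j
  proof (rule ccontr)
    assume "qb 0 (M - K * j - i) \<noteq> 0"
    then have M: "M = K * j + i"
      by (auto simp: qb_0 split: if_splits)
    have "K * (2 * j) < 0"
      using 0 assms(1) M by (simp add: algebra_simps)
    then have "j \<le> - 1"
      using assms by (simp add: mult_less_0_iff)
    then have "K * (2 * j) \<le> K * (- 2)"
      using assms by (intro mult_left_mono) auto
    then show False
      using 0 assms(1,2) M by (simp add: algebra_simps)
  qed
  then have "nonneg (hook_sum K i \<alpha> \<beta> 0 M J)" for J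
    by (auto simp: hook_sum_def intro!: nonneg_sum nonneg_mult nonneg_qb)
  then show ?case by simp
next
  case (Suc n)
  note prems = Suc.prems
  have recN: ?case if "0 < \<alpha>" "\<beta> - i < int (Suc n) - 2 * M"
  proof -
    have "\<forall>\<^sub>F J in at_top. nonneg (hook_sum K i \<alpha> \<beta> n M J)"
      by (rule Suc.IH) (use that prems in auto)
    moreover have "\<forall>\<^sub>F J in at_top. nonneg (hook_sum K i (\<alpha> - 1) (\<beta> + 1) n (M - 1) J)"
      by (rule Suc.IH) (use that prems in auto)
    ultimately show ?thesis
      unfolding hook_sum_rec_N by eventually_elim (intro nonneg_add nonneg_mult nonneg_Q)
  qed
  have recM: ?case if "0 < \<beta>" "int (Suc n) - 2 * M < K - i - \<alpha>"
  proof -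
    have "\<forall>\<^sub>F J in at_top. nonneg (hook_sum K i \<alpha> \<beta> n (M - 1) J)"
      by (rule Suc.IH) (use that prems in auto)
    moreover have "\<forall>\<^sub>F J in at_top. nonneg (hook_sum K i (\<alpha> + 1) (\<beta> - 1) n M J)"
      by (rule Suc.IH) (use that prems in auto)
    ultimately show ?thesis
      unfolding hook_sum_rec_M by eventually_elim (intro nonneg_add nonneg_mult nonneg_Q)
  qed
  \<comment> \<open>As \<alpha> + \<beta> < K, the two bounds on N - M are distinct, so one
    recurrence applies if \<alpha> and \<beta> are both positive. If one of them is 0, the other is
    positive, and its recurrence fails only at one extreme value.\<close>
  consider "\<beta> = 0" "int (Suc n) - 2 * M = - i" | "\<alpha> = 0" "int (Suc n) - 2 * M = K - i"
    | "0 < \<alpha>" "\<beta> - i < int (Suc n) - 2 * M" | "0 < \<beta>" "int (Suc n) - 2 * M < K - i - \<alpha>"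
    using prems by linarith
  then show ?case
  proof cases
    case 1
    then show ?thesis by (simp only: hook_sum_boundary_\<beta>) simp
  next
    case 2
    have "\<forall>\<^sub>F J in at_top. J > int (Suc n) + \<bar>M\<bar>"
      by (rule eventually_gt_at_top)
    then show ?thesis
    proof eventually_elim
      case (elim J)
      then show ?case
        using hook_sum_boundary_\<alpha>[OF 2(2) _ elim] 2(1) assms(1,2) by simp
    qed
  qed (use recN recM in auto)
qed

section \<open>Doubling the offsets by the kernel expansions\<close>

text \<open>The kernel \<open>\<kappa>\<close> is independent of \<open>z\<close>, so the sums can
  be swapped. Only finitely many \<open>m\<close> occur, so one threshold for \<open>J\<close> suits
  them all.\<close>

lemma eventually_nonneg_transform:
  fixes I :: "int \<Rightarrow> 'a set"
  assumes "\<And>m. m \<in> {0..int L} \<Longrightarrow> \<forall>\<^sub>F J in at_top. nonneg (\<Sum>z\<in>I J. w z * B m z)"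
    and "\<And>m. nonneg (\<kappa> m)"
    and Y: "\<And>z. Y z = (\<Sum>m=0..int L. \<kappa> m * B m z)"
  shows "\<forall>\<^sub>F J in at_top. nonneg (\<Sum>z\<in>I J. w z * Y z)"
proof -
  have "\<forall>\<^sub>F J in at_top. \<forall>m\<in>{0..int L}. nonneg (\<Sum>z\<in>I J. w z * B m z)"
    using assms(1) by (intro eventually_ball_finite) auto
  then show ?thesis
  proof eventually_elim
    case (elim J)
    have "(\<Sum>z\<in>I J. w z * Y z) = (\<Sum>m=0..int L. \<kappa> m * (\<Sum>z\<in>I J. w z * B m z))"
      unfolding Y sum_distrib_left by (subst sum.swap) (simp add: mult_ac)
    also have "nonneg \<dots>"
      by (rule nonneg_sum, rule nonneg_mult[OF assms(2)]) (use elim in blast)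
    finally show ?case .
  qed
qed

text \<open>The multiple of the triangular number \<open>v * (v + 1) div 2\<close> accumulated by
  the expansions; it equals (4^k - 1)/3.\<close>

fun geom4 :: "nat \<Rightarrow> int" where
  "geom4 0 = 0"
| "geom4 (Suc k) = geom4 k + 4 ^ k"

lemma geom4_closed: "3 * geom4 k = 4 ^ k - 1"
  by (induction k) auto

text \<open>The odd expansion turns offset \<open>v\<close> into doubled offset
  \<open>2 * v + 1\<close>. Each even expansion at x = 2^k (2 v + 1) doubles x and adds x^2/2,
  rounded down, to the exponent. With t = v (v + 1)/2, x^2 = 4^k (8 t + 1), so the multiple of t
  grows by 4^(k+1).\<close>

lemma iterated_nonneg:
  fixes I :: "int \<Rightarrow> 'a set"
  assumes base: "\<And>m. \<forall>\<^sub>F J in at_top. nonneg (\<Sum>z\<in>I J. w z * qb m ((int m - v z) div 2))"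
  shows "\<forall>\<^sub>F J in at_top. nonneg (\<Sum>z\<in>I J.
    w z * Q (geom4 (Suc k) * (v z * (v z + 1) div 2)) * qbc m (2 ^ k * (2 * v z + 1)))"
proof (induction k arbitrary: m)
  case 0
  show ?case
  proof (cases "even m")
    \<comment> \<open>The doubled offset is odd here and even in all later steps, so
      \<open>qbc\<close> vanishes on rows of the other parity.\<close>
    case True
    then show ?thesis by (simp add: qbc_def)
  next
    case False
    then obtain L where m: "m = 2 * L + 1" by (elim oddE)
    have "\<forall>\<^sub>F J in at_top. nonneg (\<Sum>z\<in>I J.
        w z * (Q (v z * (v z + 1) div 2) * qb (2 * L + 1) (int L - v z)))"
    proof (rule eventually_nonneg_transform[OF _ nonneg_kern qb_odd_transform])
      fix n :: int
      assume "n \<in> {0..int L}"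
      then show "\<forall>\<^sub>F J in at_top. nonneg (\<Sum>z\<in>I J. w z * qb (nat n) ((n - v z) div 2))"
        using base[of "nat n"] by simp
    qed
    moreover have "qbc m (2 * v z + 1) = qb (2 * L + 1) (int L - v z)" for z
    proof -
      have "int m - (2 * v z + 1) = 2 * (int L - v z)" by (simp add: m)
      then show ?thesis by (simp add: qbc_def m)
    qed
    ultimately show ?thesis
      by (simp add: mult.assoc)
  qed
next
  case (Suc k)
  show ?case
  proof (cases "even m")
    case False
    then show ?thesis by (simp add: qbc_def)
  next
    case True
    then obtain L where m: "m = 2 * L" by (elim evenE)
    define x where "x z = 2 ^ k * (2 * v z + 1)" for z
    define t where "t z = v z * (v z + 1) div 2" for z
    let ?u = "geom4 (Suc k)"
    have "\<forall>\<^sub>F J in at_top. nonneg (\<Sum>z\<in>I J.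
        w z * Q (?u * t z) * (Q (x z * x z div 2) * qb (2 * L) (int L - x z)))"
      by (rule eventually_nonneg_transform[OF _ nonneg_kern qb_even_transform])
         (use Suc in \<open>auto simp: x_def t_def\<close>)
    \<comment> \<open>The part \<open>4 ^ k div 2\<close> of the exponent is the same for all
      \<open>z\<close>; as a common factor it does not affect positivity.\<close>
    moreover have "w z * Q (?u * t z) * (Q (x z * x z div 2) * qb (2 * L) (int L - x z)) =
        Q (4 ^ k div 2) * (w z * Q (geom4 (Suc (Suc k)) * t z) * qbc m (2 * x z))" for z
    proof -
      have "int m - 2 * x z = 2 * (int L - x z)" by (simp add: m)
      then have b: "qbc m (2 * x z) = qb (2 * L) (int L - x z)" by (simp add: qbc_def m)
      have "2 * t z = v z * (v z + 1)" by (simp add: t_def)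
      then have "(2 * v z + 1) * (2 * v z + 1) = 8 * t z + 1" by (simp add: algebra_simps)
      moreover have "2 ^ k * 2 ^ k = (4 :: int) ^ k" by (simp add: power_mult_distrib[symmetric])
      moreover have "x z * x z = 2 ^ k * 2 ^ k * ((2 * v z + 1) * (2 * v z + 1))"
        unfolding x_def by (simp only: mult_ac)
      ultimately have "x z * x z = 4 ^ k * (8 * t z + 1)"
        by (simp only:)
      also have "\<dots> = 4 ^ k + 2 * (4 * 4 ^ k * t z)" by (simp add: algebra_simps)
      finally have "x z * x z div 2 = 4 ^ k div 2 + 4 * 4 ^ k * t z" by simp
      then have "?u * t z + x z * x z div 2 = 4 ^ k div 2 + geom4 (Suc (Suc k)) * t z"
        by (simp add: algebra_simps)
      then have "Q (?u * t z) * Q (x z * x z div 2) = Q (4 ^ k div 2) * Q (geom4 (Suc (Suc k)) * t z)"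
        unfolding Q_add[symmetric] by simp
      then show ?thesis
        unfolding b by (simp only: mult.assoc mult.left_commute[of "Q _" "w z"]) (simp only: mult.assoc[symmetric])
    qed
    ultimately have "\<forall>\<^sub>F J in at_top. nonneg (\<Sum>z\<in>I J. w z * Q (geom4 (Suc (Suc k)) * t z) * qbc m (2 * x z))"
      by (simp only: sum_distrib_left[symmetric] nonneg_Q_mult_iff)
    then show ?thesis
      unfolding x_def t_def power_Suc mult.assoc .
  qed
qed

section \<open>Passage from rational exponents to Laurent series, and the final assembly\<close>

lemma shifted_coeff_of_int:
  "shifted_coeff (of_int a) (qbinom (int n) k) (of_int e) = fls_nth (Q a * qb n k) e"
proof -
  have "(of_int e - of_int a :: rat) = of_int (e - a)" by simp
  then show ?thesis
    unfolding shifted_coeff_def Q_mult_nth qb_def by (simp del: of_int_diff)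
qed

lemma shifted_coeff_not_int:
  assumes "e \<notin> \<int>"
  shows "shifted_coeff (of_int a) P e = 0"
proof -
  have "e - of_int a \<notin> \<int>"
    using assms by (metis Ints_add Ints_of_int diff_add_cancel)
  then show ?thesis
    by (simp add: shifted_coeff_def)
qed

text \<open>Although \<alpha> and \<beta> may be fractions, all exponents are integers
  \<open>a j\<close> and \<open>b j\<close>. Hence coefficients at non-integral \<open>e\<close> are
  0, and the others are read off a cut-off sum whose \<open>J\<close> exceeds every index with a
  nonzero term.\<close>

lemma D_nonnegI:
  fixes a b :: "int \<Rightarrow> int"
  assumes K: "K > 0" and N: "N = int n - M"
    and a: "\<And>j. of_int j * ((\<alpha> + \<beta>) * of_int K * of_int j + of_int K * \<beta> - (\<alpha> + \<beta>) * of_int i) = of_int (a j)"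
    and b: "\<And>j. ((\<alpha> + \<beta>) * of_int j + \<beta>) * (of_int K * of_int j + of_int i) = of_int (b j)"
    and pos: "\<forall>\<^sub>F J in at_top. nonneg (\<Sum>j=-J..J. Q (a j) * qb n (M - K * j) - Q (b j) * qb n (M - K * j - i))"
  shows "D_nonneg K i N M \<alpha> \<beta>"
  unfolding D_nonneg_def
proof
  fix e :: rat
  let ?S = "{j. qbinom (M + N) (M - K * j) \<noteq> 0 \<or> qbinom (M + N) (M - K * j - i) \<noteq> 0}"
  have MN: "M + N = int n" using N by simp
  have D: "D_coeff K i N M \<alpha> \<beta> e = (\<Sum>j\<in>?S. shifted_coeff (of_int (a j)) (qbinom (int n) (M - K * j)) e
      - shifted_coeff (of_int (b j)) (qbinom (int n) (M - K * j - i)) e)"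
    unfolding D_coeff_def a b MN ..
  show "D_coeff K i N M \<alpha> \<beta> e \<ge> 0"
  proof (cases "e \<in> \<int>")
    case False
    then show ?thesis
      unfolding D by (simp add: shifted_coeff_not_int)
  next
    case True
    then obtain e' where e: "e = of_int e'" by (elim Ints_cases)
    have "\<forall>\<^sub>F J in at_top. J > int n + \<bar>M\<bar> + \<bar>i\<bar>"
      by (rule eventually_gt_at_top)
    with pos have "\<forall>\<^sub>F J in at_top. J > int n + \<bar>M\<bar> + \<bar>i\<bar> \<and>
        nonneg (\<Sum>j=-J..J. Q (a j) * qb n (M - K * j) - Q (b j) * qb n (M - K * j - i))"
      by eventually_elim simp
    then obtain J where J: "J > int n + \<bar>M\<bar> + \<bar>i\<bar>" and
        nn: "nonneg (\<Sum>j=-J..J. Q (a j) * qb n (M - K * j) - Q (b j) * qb n (M - K * j - i))"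
      using eventually_happens'[OF trivial_limit_at_top_linorder] by blast
    have sub: "?S \<subseteq> {-J..J}"
    proof
      fix j assume j: "j \<in> ?S"
      have "\<bar>j\<bar> \<le> \<bar>K * j\<bar>"
        using K by (simp add: abs_mult mult_le_cancel_right1)
      moreover have "\<bar>K * j\<bar> \<le> int n + \<bar>M\<bar> + \<bar>i\<bar>"
        using j unfolding MN by (auto simp: qbinom_def split: if_splits)
      ultimately show "j \<in> {-J..J}"
        using J by auto
    qed
    have "D_coeff K i N M \<alpha> \<beta> e = (\<Sum>j=-J..J. shifted_coeff (of_int (a j)) (qbinom (int n) (M - K * j)) e
      - shifted_coeff (of_int (b j)) (qbinom (int n) (M - K * j - i)) e)"
      unfolding D
    proof (rule sum.mono_neutral_left)
      show "\<forall>j\<in>{-J..J} - ?S. shifted_coeff (of_int (a j)) (qbinom (int n) (M - K * j)) e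
          - shifted_coeff (of_int (b j)) (qbinom (int n) (M - K * j - i)) e = 0"
        unfolding MN by (auto simp: shifted_coeff_def)
    qed (use sub in auto)
    also have "\<dots> = fls_nth (\<Sum>j=-J..J. Q (a j) * qb n (M - K * j) - Q (b j) * qb n (M - K * j - i)) e'"
      unfolding e shifted_coeff_of_int by (induction rule: infinite_finite_induct) simp_all
    finally show ?thesis
      using nn by (simp add: nonneg_def)
  qed
qed

theorem theorem2p3:
  fixes L p p' r s :: int and n :: nat
  assumes "L \<ge> 0" and "p > 0" and "p' > p" and "n \<ge> 2"
    and "0 < r" and "r < p" and "0 < s" and "s < p'"
  shows "D_nonneg (2 ^ n * p') (2 ^ n * s)
           (L + 2 ^ (n - 2) + 2 ^ (n - 1) * (r - s))
           (L - 2 ^ (n - 2) - 2 ^ (n - 1) * (r - s))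
           ((((2 ^ (2 * n) - 1) / 3) * (2 * of_int p' - 1) - ((2 ^ (2 * n + 1) + 1) / 3) * of_int r + of_int p) / 2 ^ n)
           ((((2 ^ (2 * n + 1) + 1) / 3) * of_int r + (2 ^ (2 * n) - 1) / 3) / 2 ^ n)"
proof -
  \<comment> \<open>\<open>iterated_nonneg\<close> starts from n = 1 at index 0, so it is needed at
    index \<open>Suc k\<close>.\<close>
  obtain k where n: "n = Suc (Suc k)"
    using \<open>n \<ge> 2\<close> by (metis One_nat_def Suc_1 Suc_le_D Suc_le_mono)
  define u where "u = geom4 n"
  define L' where "L' = nat L"
  have L: "L = int L'" using \<open>L \<ge> 0\<close> by (simp add: L'_def)
  define M where "M = L - 2 ^ k - 2 ^ Suc k * (r - s)"
  \<comment> \<open>A pair \<open>(j, c)\<close> indexes both families of terms, \<open>c\<close>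
    marking the subtracted one. \<open>v\<close> is the offset and \<open>w\<close> the signed power
    of q in D with K = p', i = s, \<alpha> = p - r, \<beta> = r; \<open>a\<close> and
    \<open>b\<close> are the exponents after adding \<open>u * t\<close> and removing the constant
    \<open>u * t0\<close>.\<close>
  define v where "v = (\<lambda>(j, c). r - s + 2 * (p' * j + (if c then s else 0)))"
  define t where "t z = v z * (v z + 1) div 2" for z
  define t0 where "t0 = (r - s) * (r - s + 1) div 2"
  define w where "w = (\<lambda>(j, c). if c then - Q ((p * j + r) * (p' * j + s))
      else Q (j * (p * p' * j + p' * r - p * s)))"
  define a where "a j = j * ((2 * u * p' + p) * (p' * j) + p' * ((2 * u + 1) * r + u) - (2 * u * p' + p) * s)" for j
  define b where "b j = ((2 * u * p' + p) * j + ((2 * u + 1) * r + u)) * (p' * j + s)" for j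
  have base: "\<forall>\<^sub>F J in at_top. nonneg (\<Sum>z\<in>{-J..J} \<times> UNIV. w z * qb m ((int m - v z) div 2))" for m
  proof -
    \<comment> \<open>Rounding down makes N - M equal to r - s or r - s + 1, according to parity.
      The upper bound in \<open>hook_sum_nonneg\<close> is p' - s - (p - r), which admits r - s + 1
      because p' > p.\<close>
    define M0 where "M0 = (int m - (r - s)) div 2"
    have "r - s \<le> int m - 2 * M0" "int m - 2 * M0 \<le> r - s + 1"
      unfolding M0_def by linarith+
    then have "\<forall>\<^sub>F J in at_top. nonneg (hook_sum p' s (p - r) r m M0 J)"
      by (intro hook_sum_nonneg) (use assms in auto)
    moreover have "hook_sum p' s (p - r) r m M0 J =
        (\<Sum>z\<in>{-J..J} \<times> UNIV. w z * qb m ((int m - v z) div 2))" for J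
    proof -
      have d: "(int m - v (j, c)) div 2 = M0 - p' * j - (if c then s else 0)" for j c
      proof -
        have "int m - v (j, c) = int m - (r - s) + 2 * (- p' * j - (if c then s else 0))"
          by (simp add: v_def algebra_simps)
        then show ?thesis
          unfolding M0_def by simp
      qed
      show ?thesis
        unfolding hook_sum_def sum.cartesian_product' UNIV_bool
        by (simp add: d w_def)
    qed
    ultimately show ?thesis by simp
  qed
  have main: "\<forall>\<^sub>F J in at_top. nonneg (\<Sum>z\<in>{-J..J} \<times> UNIV.
      w z * Q (u * t z) * qbc (2 * L') (2 ^ Suc k * (2 * v z + 1)))"
    using iterated_nonneg[OF base, where k = "Suc k" and m = "2 * L'"] by (simp only: u_def n t_def)
  have "(\<Sum>z\<in>{-J..J} \<times> UNIV. w z * Q (u * t z) * qbc (2 * L') (2 ^ Suc k * (2 * v z + 1))) =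
     Q (u * t0) * (\<Sum>j=-J..J. Q (a j) * qb (2 * L') (M - 2 ^ n * p' * j)
        - Q (b j) * qb (2 * L') (M - 2 ^ n * p' * j - 2 ^ n * s))" for J
  proof -
    have q: "qbc (2 * L') (2 ^ Suc k * (2 * v (j, c) + 1)) =
        qb (2 * L') (M - 2 ^ n * p' * j - (if c then 2 ^ n * s else 0))" for j c
    proof -
      have "int (2 * L') - 2 ^ Suc k * (2 * v (j, c) + 1) =
        2 * (M - 2 ^ n * p' * j - (if c then 2 ^ n * s else 0))"
        by (simp add: v_def M_def L n algebra_simps)
      then show ?thesis by (simp add: qbc_def)
    qed
    have t: "t (j, c) = t0 + x" if "v (j, c) * (v (j, c) + 1) = (r - s) * (r - s + 1) + 2 * x" for j c x
      unfolding t_def t0_def that by simp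
    have tF: "t (j, False) = t0 + p' * j * (2 * p' * j + 2 * (r - s) + 1)" for j
      by (rule t) (simp add: v_def algebra_simps)
    have F: "Q (j * (p * p' * j + p' * r - p * s)) * Q (u * t (j, False)) = Q (u * t0) * Q (a j)" for j
      unfolding Q_add[symmetric] tF by (simp add: a_def algebra_simps)
    have tT: "t (j, True) = t0 + (p' * j + s) * (2 * p' * j + 2 * r + 1)" for j
      by (rule t) (simp add: v_def algebra_simps)
    have T: "Q ((p * j + r) * (p' * j + s)) * Q (u * t (j, True)) = Q (u * t0) * Q (b j)" for j
      unfolding Q_add[symmetric] tT by (simp add: b_def algebra_simps)
    have "w (j, False) * Q (u * t (j, False)) = Q (u * t0) * Q (a j)"
      "w (j, True) * Q (u * t (j, True)) = - (Q (u * t0) * Q (b j))" for j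
      using F T by (simp_all add: w_def)
    then show ?thesis
      unfolding sum_distrib_left sum.cartesian_product' UNIV_bool
      by (intro sum.cong refl) (simp add: q right_diff_distrib mult.assoc[symmetric] del: power_Suc)
  qed
  with main have pos: "\<forall>\<^sub>F J in at_top. nonneg (\<Sum>j=-J..J. Q (a j) * qb (2 * L') (M - 2 ^ n * p' * j)
        - Q (b j) * qb (2 * L') (M - 2 ^ n * p' * j - 2 ^ n * s))"
    by (simp only: nonneg_Q_mult_iff)
  define K where "K = (2 :: rat) ^ n"
  have K0: "K \<noteq> 0" by (simp add: K_def)
  have "3 * (of_int u :: rat) = of_int (3 * u)" by simp
  also have "3 * u = 2 ^ (2 * n) - 1"
    unfolding u_def geom4_closed by (simp add: power_mult)
  finally have u: "(2 ^ (2 * n) - 1) / 3 = (of_int u :: rat)" by simp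
  have u': "(2 ^ (2 * n + 1) + 1) / 3 = (2 * of_int u + 1 :: rat)"
    unfolding u[symmetric] by (simp add: field_simps)
  let ?\<alpha> = "(of_int u * (2 * of_int p' - 1) - (2 * of_int u + 1) * of_int r + of_int p) / K :: rat"
  let ?\<beta> = "((2 * of_int u + 1) * of_int r + of_int u) / K :: rat"
  \<comment> \<open>The multiples of r cancel; the denominator 2^n left in the sum is cancelled by
    the factor 2^n in K and i, which makes the exponents integral.\<close>
  have sum: "?\<alpha> + ?\<beta> = (2 * of_int u * of_int p' + of_int p) / K"
    by (simp add: add_divide_distrib[symmetric] algebra_simps)
  have idx: "n - 2 = k" "n - 1 = Suc k" by (simp_all add: n)
  show ?thesis
    unfolding u u' idx M_def[symmetric] K_def[symmetric]
  proof (rule D_nonnegI[OF _ _ _ _ pos])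
    show "0 < 2 ^ n * p'" using assms by simp
    show "L + 2 ^ k + 2 ^ Suc k * (r - s) = int (2 * L') - M" by (simp add: M_def L)
    have K': "of_int (2 ^ n * x) = K * of_int x" for x by (simp add: K_def)
    show "of_int j * ((?\<alpha> + ?\<beta>) * of_int (2 ^ n * p') * of_int j + of_int (2 ^ n * p') * ?\<beta>
        - (?\<alpha> + ?\<beta>) * of_int (2 ^ n * s)) = of_int (a j)" for j
      unfolding sum K' a_def using K0 by (simp add: field_simps)
    show "((?\<alpha> + ?\<beta>) * of_int j + ?\<beta>) * (of_int (2 ^ n * p') * of_int j + of_int (2 ^ n * s)) = of_int (b j)" for j
    proof -
      have "((?\<alpha> + ?\<beta>) * of_int j + ?\<beta>) = ((2 * of_int u * of_int p' + of_int p) * of_int j + ((2 * of_int u + 1) * of_int r + of_int u)) / K"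
        unfolding sum by (simp add: add_divide_distrib distrib_right)
      moreover have "of_int (2 ^ n * p') * of_int j + of_int (2 ^ n * s) = K * of_int (p' * j + s)"
        unfolding K' by (simp add: algebra_simps)
      ultimately show ?thesis
        using K0 by (simp add: b_def)
    qed
  qed
qed

end
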